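(* Let $\nu_k=\nu^{(k)}(0)/k!$ be the Taylor coefficients at $0$ of $\nu(z) = \frac{1}{\Gamma(z+1)}\prod_{p}\left(1-\frac{z}{p}\right)^{-1}\left(1-\frac{1}{p}\right)^z$. Then, as $k\to\infty$, $\nu_k = \beta_2\, 2^{-k}+O(3^{-k})$, where $\beta_2=\frac18\prod_{p>2}\frac{(1-1/p)^2}{1-2/p}\approx 0.1893475$. Moreover, for any prime $q$, \[ \nu_k = \sum_{p<q}\beta_p\, p^{-k} + O_q(q^{-k}), \] where for each prime $p$ \[ \beta_p := \frac{(1-1/p)^p}{p!}\prod_{p'\ne p}\Big(1-\frac{p}{p'}\Big)^{-1}\Big(1-\frac{1}{p'}\Big)^{p}, \] the product being over primes $p'\neq p$.
   Context: $p,p',q$ denote primes; $\Gamma$ is the Euler gamma function. *)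

theory Defs
  imports
    "HOL-Complex_Analysis.Complex_Analysis"
    "HOL-Library.Landau_Symbols"
    "HOL-Computational_Algebra.Primes"
begin

text \<open>
  A product over the primes satisfying \<open>P\<close>, taken in increasing order: the index runs over all
  natural numbers, and those that are not selected contribute the factor \<open>1\<close>.
\<close>

definition prime_prod :: "(nat \<Rightarrow> bool) \<Rightarrow> (nat \<Rightarrow> 'a) \<Rightarrow> 'a :: {t2_space, comm_semiring_1}" where
  "prime_prod P f = (\<Prod>p. if prime p \<and> P p then f p else 1)"

text \<open>
  At the poles of \<open>\<nu>\<close> (the primes) the value below is an artefact of \<open>inverse 0 = 0\<close>; at the
  poles of \<open>Gamma (z + 1)\<close> the convention \<open>1 / 0 = 0\<close> gives the correct value of the entire
  function \<open>1 / Gamma (z + 1)\<close>.  Only the germ of \<open>\<nu>\<close> at \<open>0\<close> matters for its Taylor coefficients.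
\<close>

definition nu :: "complex \<Rightarrow> complex" where
  "nu z = 1 / Gamma (z + 1) *
     prime_prod (\<lambda>p. True) (\<lambda>p. inverse (1 - z / of_nat p) * (1 - 1 / of_nat p) powr z)"

definition nu_coeff :: "nat \<Rightarrow> complex" where
  "nu_coeff k = (deriv ^^ k) nu 0 / fact k"

definition beta :: "nat \<Rightarrow> real" where
  "beta p = (1 - 1 / real p) ^ p / fact p *
     prime_prod (\<lambda>p'. p' \<noteq> p) (\<lambda>p'. inverse (1 - real p / real p') * (1 - 1 / real p') ^ p)"

end

theory Submission
  imports Defs "HOL-Real_Asymp.Real_Asymp"
begin

text \<open>
  Near the origin, \<open>\<nu>(z) = F(z) \<Prod>\<^bsub>p \<le> q\<^esub> (1 - z/p)\<^sup>-\<^sup>1\<close>, where \<open>F\<close> collects \<open>1/\<Gamma>(z+1)\<close>, the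
  factors \<open>(1 - 1/p)\<^sup>z\<close> with \<open>p \<le> q\<close> and the part of the Euler product over \<open>p > q\<close>; it is holomorphic
  for \<open>|z| < q + 1\<close>.  Partial fractions turn this into \<open>\<nu>(z) = H(z) + \<Sum>\<^bsub>p \<le> q\<^esub> \<beta>\<^sub>p (1 - z/p)\<^sup>-\<^sup>1\<close> with
  \<open>H\<close> holomorphic on the same disc, and Cauchy's inequality on \<open>|z| = q\<close> bounds the coefficients
  of \<open>H\<close>.  The numerical value of \<open>\<beta>\<^sub>2\<close> comes from accelerating the convergence of its product by
  means of \<open>\<zeta>(2)\<close>, \<open>\<zeta>(3)\<close> and \<open>\<zeta>(4)\<close>.
\<close>

section \<open>The tail of the Euler product\<close>

definition euler_factor :: "nat \<Rightarrow> complex \<Rightarrow> complex" where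
  "euler_factor p z = inverse (1 - z / of_nat p) * (1 - 1 / of_nat p) powr z"

text \<open>For a prime p this is a holomorphic logarithm of \<open>euler_factor p\<close> on |z| <
  p: there \<open>1 - z / p\<close> has positive real part, so the principal branch serves.\<close>

definition log_euler_factor :: "nat \<Rightarrow> complex \<Rightarrow> complex" where
  "log_euler_factor p z = z * Ln (1 - 1 / of_nat p) - Ln (1 - z / of_nat p)"

text \<open>Written as the exponential of a series, the tail product inherits holomorphy from
  locally uniform convergence of sums, and it never vanishes.\<close>

definition euler_tail :: "nat \<Rightarrow> complex \<Rightarrow> complex" where
  "euler_tail q z = exp (\<Sum>n. if prime n \<and> q < n then log_euler_factor n z else 0)"

lemma exp_log_euler_factor:
  assumes "p > 1" "norm z < real p"
  shows "exp (log_euler_factor p z) = euler_factor p z"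
proof -
  have 1: "1 - z / of_nat p \<noteq> 0"
  proof
    assume "1 - z / of_nat p = 0"
    hence "z = of_nat p" using assms by (simp add: field_simps)
    thus False using assms by simp
  qed
  have 2: "1 - 1 / (of_nat p :: complex) \<noteq> 0"
    using assms by (simp add: field_simps)
  show ?thesis unfolding log_euler_factor_def euler_factor_def exp_diff exp_Ln[OF 1] powr_def
    using 2 by (simp add: divide_inverse)
qed

text \<open>With \<open>u = -1/p\<close> and \<open>w = -z/p\<close> the linear terms of the two
  logarithms cancel, because \<open>z * u = w\<close>. What is left is quadratic in 1/p, uniformly
  for |z| \<le> R, since |w| \<le> R/(q+1) < 1.\<close>

lemma norm_log_euler_factor_le:
  assumes R: "norm z \<le> R" "R < real q + 1" and p: "1 \<le> q" "q < p"
  shows "norm (log_euler_factor p z) \<le> (R\<^sup>2 / (1 - R / (real q + 1)) + 2 *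
      R) / (real p)\<^sup>2"
proof -
  define w u where "w = - z / of_nat p" and "u = - 1 / (of_nat p :: complex)"
  have p1: "real p \<ge> real q + 1" "real q \<ge> 1" using p by auto
  have R0: "R \<ge> 0" using R norm_ge_zero order_trans by blast
  have nw: "norm w = norm z / real p" by (simp add: w_def norm_divide)
  have nu: "norm u = 1 / real p" by (simp add: u_def norm_divide)
  have c: "1 - R / (real q + 1) > 0" using R p1 by (simp add: field_simps)
  have wR: "norm w \<le> R / real p" unfolding nw using R p1 by (simp add: divide_right_mono)
  have "R / real p \<le> R / (real q + 1)" using R0 p1 by (intro divide_left_mono) auto
  hence wc: "1 - norm w \<ge> 1 - R / (real q + 1)" using wR by linarith
  hence w1: "norm w < 1" using c by linarith
  have u1: "norm u \<le> 1/2" unfolding nu using p1 by (simp add: field_simps)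
  have A: "norm (Ln (1 + w) - w) \<le> (R / real p)\<^sup>2 / (1 - R / (real q + 1))"
    using Ln_approx_linear[OF w1] frac_le[OF _ power_mono[OF wR norm_ge_zero] c wc, of 2]
    by (meson order_trans zero_le_power2)
  have "norm (Ln (1 + u) - u) \<le> (norm u)\<^sup>2 / (1 - norm u)"
    using u1 by (intro Ln_approx_linear) auto
  also have "\<dots> \<le> (norm u)\<^sup>2 / (1/2)" using u1 by (intro divide_left_mono) auto
  finally have B: "norm (Ln (1 + u) - u) \<le> 2 / (real p)\<^sup>2" by (simp add: nu power_divide)
  have "log_euler_factor p z = z * (Ln (1 + u) - u) - (Ln (1 + w) - w)"
    by (simp add: log_euler_factor_def w_def u_def algebra_simps)
  also have "norm \<dots> \<le> norm z * norm (Ln (1 + u) - u) + norm (Ln (1 + w) - w)"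
    by (metis norm_mult norm_triangle_ineq4)
  also have "\<dots> \<le> R *
      (2 / (real p)\<^sup>2) + (R / real p)\<^sup>2 / (1 - R / (real q + 1))"
    using R R0 A B by (intro add_mono mult_mono) auto
  also have "\<dots> = (R\<^sup>2 / (1 - R / (real q + 1)) + 2 * R) / (real p)\<^sup>2"
    by (simp add: power_divide add_divide_distrib mult.commute)
  finally show ?thesis .
qed

lemma log_euler_factor_uniform_limit:
  assumes "1 \<le> q" "R < real q + 1"
  shows "uniform_limit (cball 0 R)
           (\<lambda>n z. \<Sum>i<n. if prime i \<and> q < i then log_euler_factor i z else 0)
           (\<lambda>z. \<Sum>i. if prime i \<and> q < i then log_euler_factor i z else 0) sequentially"
    and "norm z \<le> R \<Longrightarrow> summable (\<lambda>i. if prime i \<and> q < i then log_euler_factor i z else 0)"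
proof -
  define C where "C = R\<^sup>2 / (1 - R / (real q + 1)) + 2 * R"
  \<comment> \<open>The absolute value makes the majorant nonnegative, as the indices with term 0
    require.\<close>
  have le: "norm (if prime i \<and> q < i then log_euler_factor i z else 0) \<le> \<bar>C\<bar> / (real i)\<^sup>2"
    if "norm z \<le> R" for i z
    using norm_log_euler_factor_le[OF that assms(2,1), of i]
      divide_right_mono[OF abs_ge_self[of C], of "(real i)\<^sup>2"]
    by (auto simp add: C_def[symmetric] prime_gt_0_nat)
  have "summable (\<lambda>i. \<bar>C\<bar> * inverse ((real i)\<^sup>2))"
    by (intro summable_mult inverse_power_summable) auto
  hence sm: "summable (\<lambda>i. \<bar>C\<bar> / (real i)\<^sup>2)" by (simp add: divide_inverse)
  show "uniform_limit (cball 0 R)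
           (\<lambda>n z. \<Sum>i<n. if prime i \<and> q < i then log_euler_factor i z else 0)
           (\<lambda>z. \<Sum>i. if prime i \<and> q < i then log_euler_factor i z else 0) sequentially"
    by (intro Weierstrass_m_test[OF _ sm] le) simp
  show "summable (\<lambda>i. if prime i \<and> q < i then log_euler_factor i z else 0)" if "norm z \<le> R"
    using le[OF that] by (intro summable_comparison_test[OF _ sm]) auto
qed

lemma euler_tail_holomorphic:
  assumes "1 \<le> q"
  shows "euler_tail q holomorphic_on ball 0 (real q + 1)"
proof -
  have "(\<lambda>z. \<Sum>i. if prime i \<and> q < i then log_euler_factor i z else 0)
          holomorphic_on ball 0 (real q + 1)"
  proof (rule holomorphic_uniform_sequence)
    fix n
    have "(\<lambda>z. if prime i \<and> q < i then log_euler_factor i z else 0)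
            holomorphic_on ball 0 (real q + 1)" for i
    proof (cases "prime i \<and> q < i")
      case True
      have "1 - z / of_nat i \<notin> \<real>\<^sub>\<le>\<^sub>0" if "z \<in> ball 0 (real q + 1)" for z :: complex
      proof
        assume *: "1 - z / of_nat i \<in> \<real>\<^sub>\<le>\<^sub>0"
        hence "1 \<le> Re (z / of_nat i)" by (auto simp: complex_nonpos_Reals_iff)
        also have "\<dots> \<le> norm (z / of_nat i)" by (rule complex_Re_le_cmod)
        also have "\<dots> < 1" using that True by (auto simp: norm_divide field_simps)
        finally show False by simp
      qed
      thus ?thesis using True unfolding log_euler_factor_def
        by (auto intro!: holomorphic_intros)
    qed auto
    thus "(\<lambda>z. \<Sum>i<n. if prime i \<and> q < i then log_euler_factor i z else 0)
            holomorphic_on ball 0 (real q + 1)"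
      by (intro holomorphic_on_sum)
  next
    fix x :: complex assume x: "x \<in> ball 0 (real q + 1)"
    then obtain d where d: "d > 0" "cball x d \<subseteq> ball 0 (real q + 1)"
      using open_contains_cball by (metis open_ball)
    \<comment> \<open>Uniform convergence is known on discs about 0 of radius below q + 1. Half the
      distance from x to the boundary keeps \<open>cball x d'\<close> inside such a disc.\<close>
    define d' where "d' = min d ((real q + 1 - norm x) / 2)"
    have d': "d' > 0" "cball x d' \<subseteq> ball 0 (real q + 1)" using d x by (auto simp: d'_def)
    have sub: "cball x d' \<subseteq> cball 0 (norm x + d')"
      by (simp add: cball_subset_cball_iff)
    have lt: "norm x + d' < real q + 1" using x by (auto simp: d'_def min_def field_simps)
    show "\<exists>d>0. cball x d \<subseteq> ball 0 (real q + 1) \<and> uniform_limit (cball x d)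
        (\<lambda>n z. \<Sum>i<n. if prime i \<and> q < i then log_euler_factor i z else 0)
        (\<lambda>z. \<Sum>i. if prime i \<and> q < i then log_euler_factor i z else 0) sequentially"
      by (intro exI[of _ d'] conjI d'
            uniform_limit_on_subset[OF log_euler_factor_uniform_limit(1)[OF assms lt] sub])
  qed auto
  thus ?thesis unfolding euler_tail_def by (intro holomorphic_on_exp')
qed

lemma euler_tail_has_prod:
  assumes "1 \<le> q" "norm z < real q + 1"
  shows "(\<lambda>n. if prime n \<and> q < n then euler_factor n z else 1) has_prod euler_tail q z"
proof -
  define f where "f = (\<lambda>n. if prime n \<and> q < n then log_euler_factor n z else 0)"
  have "summable f"
    using log_euler_factor_uniform_limit(2)[OF assms] by (simp add: f_def)
  hence "f sums (\<Sum>n. f n)" by (rule summable_sums)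
  hence "(\<lambda>n. exp (f n)) has_prod exp (\<Sum>n. f n)"
    using sums_imp_has_prod_exp by (auto simp: has_prod_def)
  moreover have "exp (f n) = (if prime n \<and> q < n then euler_factor n z else 1)" for n
    using assms by (auto simp: f_def prime_gt_1_nat intro!: exp_log_euler_factor)
  ultimately show ?thesis unfolding euler_tail_def f_def[symmetric] by simp
qed

text \<open>The condition \<open>P\<close> can exclude only primes up to q, so it affects finitely
  many factors and leaves the tail intact. It is used with \<open>P\<close> true for
  \<open>nu\<close> and with \<open>n \<noteq> p\<close> for \<open>beta p\<close>.\<close>

lemma prime_prod_split:
  fixes h :: "nat \<Rightarrow> 'a :: real_normed_field"
  assumes "(\<lambda>n. if prime n \<and> q < n then h n else 1) has_prod t"
    and "\<And>n. prime n \<Longrightarrow> q < n \<Longrightarrow> P n"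
  shows "(\<lambda>n. if prime n \<and> P n then h n else 1) has_prod
           ((\<Prod>n | prime n \<and> n \<le> q \<and> P n. h n) * t)"
    and "prime_prod P h = (\<Prod>n | prime n \<and> n \<le> q \<and> P n. h n) * t"
proof -
  have fin: "finite {n. prime n \<and> n \<le> q \<and> P n}" by (rule finite_subset[of _ "{..q}"]) auto
  have "(\<lambda>n. (if prime n \<and> n \<le> q \<and> P n then h n else 1) *
      (if prime n \<and> q < n then h n else 1))
          has_prod ((\<Prod>n | prime n \<and> n \<le> q \<and> P n. h n) * t)"
    by (intro has_prod_mult has_prod_If_finite fin assms(1))
  also have "(\<lambda>n. (if prime n \<and> n \<le> q \<and> P n then h n else 1) *
      (if prime n \<and> q < n then h n else 1)) = (\<lambda>n. if prime n \<and> P n then h n else 1)"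
    using assms(2) by (auto simp: fun_eq_iff)
  finally show "(\<lambda>n. if prime n \<and> P n then h n else 1) has_prod
           ((\<Prod>n | prime n \<and> n \<le> q \<and> P n. h n) * t)" .
  thus "prime_prod P h = (\<Prod>n | prime n \<and> n \<le> q \<and> P n. h n) * t"
    unfolding prime_prod_def by (rule has_prod_unique[symmetric])
qed

text \<open>The tail is complex while \<open>beta\<close> is real. Convergence passes back through
  the embedding, so the real product has a value to be embedded.\<close>

lemma of_real_prime_prod:
  assumes "convergent_prod (\<lambda>n. if prime n \<and> P n then complex_of_real (h n) else 1)"
  shows "complex_of_real (prime_prod P h) = prime_prod P (\<lambda>n. complex_of_real (h n))"
proof -
  define f where "f = (\<lambda>n. if prime n \<and> P n then h n else 1)"
  have eq: "(\<lambda>n. if prime n \<and> P n then complex_of_real (h n) else 1) = complex_of_real \<circ> f"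
    by (auto simp: f_def fun_eq_iff)
  have "convergent_prod f" using assms unfolding eq by (simp add: convergent_prod_of_real_iff)
  hence "f has_prod prodinf f" by (rule convergent_prod_has_prod)
  hence "(complex_of_real \<circ> f) has_prod of_real (prodinf f)" by (simp add: o_def)
  thus ?thesis unfolding prime_prod_def eq by (simp add: f_def has_prod_unique)
qed

section \<open>Partial fractions\<close>

lemma nu_eq:
  assumes "1 \<le> q" "norm z < real q + 1"
  shows "nu z = rGamma (z + 1) * (\<Prod>p | prime p \<and> p \<le> q. euler_factor p z) *
      euler_tail q z"
proof -
  have "prime_prod (\<lambda>p. True) (\<lambda>p. euler_factor p z) =
          (\<Prod>p | prime p \<and> p \<le> q. euler_factor p z) * euler_tail q z"
    using prime_prod_split(2)[OF euler_tail_has_prod[OF assms], of "\<lambda>_. True"] by simp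
  thus ?thesis unfolding nu_def euler_factor_def
    by (simp add: rGamma_inverse_Gamma divide_inverse)
qed

text \<open>What remains of \<open>nu\<close> once the poles at the primes up to q are taken out;
  its values at these primes determine the residues. \<open>rGamma\<close> is entire.\<close>

definition residue_factor :: "nat \<Rightarrow> complex \<Rightarrow> complex" where
  "residue_factor q z =
     rGamma (z + 1) * (\<Prod>p | prime p \<and> p \<le> q. (1 - 1 / of_nat p) powr z) *
      euler_tail q z"

lemma residue_factor_holomorphic:
  assumes "1 \<le> q"
  shows "residue_factor q holomorphic_on ball 0 (real q + 1)"
proof -
  have "1 - 1 / (of_nat p :: complex) \<noteq> 0" if "prime p" for p
    using prime_gt_1_nat[OF that] by (simp add: field_simps)
  thus ?thesis unfolding residue_factor_def
    by (intro holomorphic_intros euler_tail_holomorphic assms)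
qed

lemma nu_eq_residue_factor:
  assumes "1 \<le> q" "norm z < real q + 1"
  shows "nu z = residue_factor q z *
      (\<Prod>p | prime p \<and> p \<le> q. inverse (1 - z / of_nat p))"
  unfolding nu_eq[OF assms] residue_factor_def euler_factor_def prod.distrib by (simp only: mult_ac)

text \<open>Induction on the set of poles. The identity \<open>key\<close> splits a product of two
  simple fractions; the coefficient at the new pole is then the induction hypothesis evaluated at
  that pole.\<close>

lemma prod_inverse_partial_fractions:
  fixes a :: "'i \<Rightarrow> 'a :: field"
  assumes "finite I" "I \<noteq> {}" "inj_on a I" "\<And>i. i \<in> I \<Longrightarrow> a i \<noteq> 0" "\<And>i. i \<in> I \<Longrightarrow> z \<noteq> a i"
  shows "(\<Prod>i\<in>I. inverse (1 - z / a i)) =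
         (\<Sum>i\<in>I. (\<Prod>j\<in>I - {i}. inverse (1 - a i / a j)) * inverse (1 - z / a i))"
  using assms
proof (induction I arbitrary: z rule: finite_ne_induct)
  case (singleton i)
  then show ?case by simp
next
  case (insert k I)
  define c where "c = (\<lambda>i. \<Prod>j\<in>I - {i}. inverse (1 - a i / a j))"
  have ak: "a k \<noteq> 0" "z \<noteq> a k" using insert.prems by auto
  have ne: "a i \<noteq> a k" "a i \<noteq> 0" "z \<noteq> a i" if "i \<in> I" for i
    using that insert.prems insert.hyps by (auto simp: inj_on_def)
  have IH: "(\<Prod>i\<in>I. inverse (1 - w / a i)) = (\<Sum>i\<in>I. c i * inverse (1 - w / a i))"
    if "\<And>i. i \<in> I \<Longrightarrow> w \<noteq> a i" for w
    using insert.IH[of w] insert.prems that by (auto simp: c_def inj_on_def)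
  have key: "inverse (1 - z / a k) * inverse (1 - z / a i) =
      inverse (1 - a i / a k) * inverse (1 - z / a i) +
      inverse (1 - a k / a i) * inverse (1 - z / a k)" if "i \<in> I" for i
  proof -
    \<comment> \<open>Used with \<open>u = a k - z\<close> and \<open>v = a i - z\<close>, whose
      difference no longer contains z.\<close>
    have pf: "x / u * (y / v) = - x / (v - u) * (y / v) + y / (v - u) * (x / u)"
      if "u \<noteq> 0" "v \<noteq> 0" "v - u \<noteq> 0" "v - u = y - x" for x y u v :: 'a
      using that(1-3) unfolding diff_eq_eq[THEN iffD1, OF that(4)[symmetric]]
      by (simp add: divide_simps) (simp add: algebra_simps)
    have nz: "a k - a i \<noteq> 0" "a i - a k \<noteq> 0" "a i - z \<noteq> 0" "a k - z \<noteq> 0"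
      using ne[OF that] ak by auto
    have eq: "inverse (1 - z / a k) = a k / (a k - z)" "inverse (1 - z / a i) = a i / (a i - z)"
      using ne[OF that] ak nz by (auto simp: field_simps)
    have eq': "inverse (1 - a i / a k) = - a k / (a i - a k)"
      "inverse (1 - a k / a i) = a i / (a i - a k)"
      using ne[OF that] ak nz by (auto simp: field_simps)
    show ?thesis unfolding eq eq' using pf[of "a k - z" "a i - z" "a i" "a k"] nz by simp
  qed
  have "(\<Prod>i\<in>insert k I. inverse (1 - z / a i)) =
        (\<Sum>i\<in>I. c i * (inverse (1 - z / a k) * inverse (1 - z / a i)))"
    using insert.hyps IH[OF ne(3)] by (simp add: sum_distrib_left mult_ac)
  also have "\<dots> = (\<Sum>i\<in>I. c i * inverse (1 - a i / a k) * inverse (1 - z / a i)) +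
      (\<Sum>i\<in>I. c i * inverse (1 - a k / a i)) * inverse (1 - z / a k)"
    unfolding sum_distrib_right sum.distrib[symmetric]
    by (intro sum.cong refl) (simp only: key mult.assoc distrib_left)
  also have "(\<Sum>i\<in>I. c i *
      inverse (1 - a k / a i)) = (\<Prod>i\<in>I. inverse (1 - a k / a i))"
    using IH[of "a k"] ne by metis
  also have "(\<Sum>i\<in>I. c i * inverse (1 - a i / a k) * inverse (1 - z / a i)) =
      (\<Sum>i\<in>I. (\<Prod>j\<in>insert k I - {i}. inverse (1 - a i / a j)) *
      inverse (1 - z / a i))"
  proof (intro sum.cong refl)
    fix i assume "i \<in> I"
    hence "insert k I - {i} = insert k (I - {i})" using insert.hyps by auto
    thus "c i * inverse (1 - a i / a k) * inverse (1 - z / a i) =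
      (\<Prod>j\<in>insert k I - {i}. inverse (1 - a i / a j)) * inverse (1 - z / a i)"
      using insert.hyps by (simp add: c_def)
  qed
  finally show ?case using insert.hyps by (simp add: add.commute)
qed

text \<open>The product in \<open>beta p\<close> splits at q: primes up to q give the finite
  products, those beyond give \<open>euler_tail q\<close> at p. The prefactor comes from the power
  belonging to p itself and from \<open>rGamma (p + 1)\<close>, which is 1/p!.\<close>

lemma beta_eq_residue:
  assumes "prime p" "p \<le> q"
  shows "convergent_prod (\<lambda>p'. if prime p' \<and> p' \<noteq> p
           then inverse (1 - real p / real p') * (1 - 1 / real p') ^ p else 1)"
    and "complex_of_real (beta p) = residue_factor q (of_nat p) *
           (\<Prod>p'\<in>{p'. prime p' \<and> p' \<le> q} - {p}. inverse (1 - of_nat p / of_nat p'))"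
proof -
  define I where "I = {p'. prime p' \<and> p' \<le> q}"
  have fin: "finite I" unfolding I_def by (rule finite_subset[of _ "{..q}"]) auto
  have q: "1 \<le> q" using assms prime_ge_1_nat[of p] by linarith
  have I': "I - {p} = {n. prime n \<and> n \<le> q \<and> n \<noteq> p}" by (auto simp: I_def)
  define h where "h = (\<lambda>p'. inverse (1 - real p / real p') * (1 - 1 / real p') ^ p)"
  have ef: "euler_factor p' (of_nat p) = complex_of_real (h p')" if "prime p'" for p'
  proof -
    have "1 - 1 / (of_nat p' :: complex) \<noteq> 0"
      using prime_gt_1_nat[OF that] by (simp add: field_simps)
    thus ?thesis by (simp add: euler_factor_def h_def powr_nat')
  qed
  have eq: "(\<lambda>n. if prime n \<and> P n then euler_factor n (of_nat p) else 1) =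
        (\<lambda>n. if prime n \<and> P n then complex_of_real (h n) else 1)" for P
    using ef by (auto simp: fun_eq_iff)
  have "(\<lambda>n. if prime n \<and> q < n then complex_of_real (h n) else 1) has_prod
          euler_tail q (of_nat p)"
    using euler_tail_has_prod[OF q, of "of_nat p"] assms unfolding eq by simp
  note split = prime_prod_split[OF this, of "\<lambda>n. n \<noteq> p"]
  have conv: "convergent_prod (\<lambda>n. if prime n \<and> n \<noteq> p then complex_of_real (h n) else 1)"
    using assms split(1) has_prod_iff by auto
  also have "(\<lambda>n. if prime n \<and> n \<noteq> p then complex_of_real (h n) else 1) =
      complex_of_real \<circ> (\<lambda>n. if prime n \<and> n \<noteq> p then h n else 1)"
    by (auto simp: fun_eq_iff)
  finally show "convergent_prod (\<lambda>p'. if prime p' \<and> p' \<noteq> p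
      then inverse (1 - real p / real p') * (1 - 1 / real p') ^ p else 1)"
    by (simp only: convergent_prod_of_real_iff h_def)
  have "complex_of_real (prime_prod (\<lambda>p'. p' \<noteq> p) h) =
          (\<Prod>n\<in>I - {p}. complex_of_real (h n)) * euler_tail q (of_nat p)"
    unfolding I' using assms by (subst of_real_prime_prod[OF conv], intro split(2)) auto
  also have "(\<Prod>n\<in>I - {p}. complex_of_real (h n)) =
      (\<Prod>n\<in>I - {p}. inverse (1 - of_nat p / of_nat n)) *
      (\<Prod>n\<in>I - {p}. (1 - 1 / of_nat n) ^ p)"
    by (simp add: h_def prod.distrib)
  finally have *: "complex_of_real (prime_prod (\<lambda>p'. p' \<noteq> p) h) =
      (\<Prod>n\<in>I - {p}. inverse (1 - of_nat p / of_nat n)) *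
      (\<Prod>n\<in>I - {p}. (1 - 1 / of_nat n) ^ p) * euler_tail q (of_nat p)" .
  have "(\<Prod>n\<in>I. (1 - 1 / complex_of_nat n) powr of_nat p) = (\<Prod>n\<in>I. (1 - 1 / of_nat n) ^ p)"
  proof (intro prod.cong refl)
    fix n assume "n \<in> I"
    hence "1 - 1 / (of_nat n :: complex) \<noteq> 0"
      using prime_gt_1_nat[of n] by (auto simp: I_def field_simps)
    thus "(1 - 1 / complex_of_nat n) powr of_nat p = (1 - 1 / of_nat n) ^ p"
      by (simp add: powr_nat')
  qed
  also have "\<dots> = (1 - 1 / of_nat p) ^ p * (\<Prod>n\<in>I - {p}. (1 - 1 / of_nat n) ^ p)"
    using assms fin by (subst prod.remove[of _ p]) (auto simp: I_def)
  finally have **: "(\<Prod>n\<in>I. (1 - 1 / complex_of_nat n) powr of_nat p) = \<dots>" .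
  have g: "rGamma (of_nat p + 1 :: complex) = 1 / fact p"
    using Gamma_fact[of p, where 'a = complex] by (simp add: rGamma_inverse_Gamma add.commute inverse_eq_divide)
  show "complex_of_real (beta p) = residue_factor q (of_nat p) *
           (\<Prod>p'\<in>{p'. prime p' \<and> p' \<le> q} - {p}. inverse (1 - of_nat p / of_nat p'))"
    unfolding beta_def residue_factor_def I_def[symmetric] ** h_def[symmetric] of_real_mult * g
    by simp
qed

section \<open>Taylor coefficients at the origin\<close>

lemma has_fps_expansion_geometric:
  fixes a :: complex
  assumes "a \<noteq> 0"
  shows "(\<lambda>z. inverse (1 - z / a)) has_fps_expansion Abs_fps (\<lambda>k. 1 / a ^ k)"
proof (rule has_fps_expansionI)
  have "eventually (\<lambda>z. z \<in> ball 0 (norm a)) (nhds (0 :: complex))"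
    using assms by (intro eventually_nhds_in_open) auto
 
      thus "\<forall>\<^sub>F z in nhds 0. (\<lambda>n. fps_nth (Abs_fps (\<lambda>k. 1 / a ^ k)) n * z ^ n) sums inverse (1 - z / a)"
  proof eventually_elim
    case (elim z)
    hence "norm (z / a) < 1" using assms by (simp add: norm_divide)
    hence "(\<lambda>n. (z / a) ^ n) sums (1 / (1 - z / a))" by (rule geometric_sums)
    thus ?case by (simp add: power_divide inverse_eq_divide)
  qed
qed

lemma Taylor_coeff_bigo:
  assumes "f holomorphic_on ball 0 R" "0 < r" "r < R"
  shows "(\<lambda>k. (deriv ^^ k) f 0 / fact k) \<in> O(\<lambda>k. 1 / of_real r ^ k)"
proof -
  have cont: "continuous_on (cball 0 r) f"
    using assms by (intro holomorphic_on_imp_continuous_on holomorphic_on_subset[OF assms(1)]) auto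
  have "compact (f ` cball 0 r)" by (intro compact_continuous_image cont) auto
  then obtain B where B: "\<And>z. z \<in> cball 0 r \<Longrightarrow> norm (f z) \<le> B"
    by (meson bounded_iff compact_imp_bounded imageI)
  have "norm ((deriv ^^ k) f 0) \<le> fact k * B / r ^ k" for k
    using assms B by (intro Cauchy_inequality cont holomorphic_on_subset[OF assms(1)]) auto
  hence "norm ((deriv ^^ k) f 0 / fact k) \<le> B * norm (1 / complex_of_real r ^ k)" for k
    using assms by (simp add: norm_divide norm_power field_simps)
  thus ?thesis by (intro bigoI[where c = B]) auto
qed

text \<open>At each pole, \<open>F z / (1 - z/p) = F p / (1 - z/p) - p * Q p z\<close>, where
  \<open>Q p\<close> is the difference quotient of \<open>F\<close> at p; the numbers
  \<open>F p * c p\<close> are the \<open>beta p\<close>. On |z| < 1 no prime is met, and this disc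
  determines the Taylor coefficients.\<close>

lemma nu_partial_fractions:
  assumes "1 < q"
  obtains H where "H holomorphic_on ball 0 (real q + 1)"
    "\<And>z. norm z < 1 \<Longrightarrow>
       nu z = H z + (\<Sum>p | prime p \<and> p \<le> q. of_real (beta p) *
      inverse (1 - z / of_nat p))"
proof -
  define I where "I = {p'. prime p' \<and> p' \<le> q}"
  define F where "F = residue_factor q"
  define c where "c = (\<lambda>p. \<Prod>p'\<in>I - {p}. inverse (1 - of_nat p / of_nat p' :: complex))"
  \<comment> \<open>The derivative fills the removable singularity, so \<open>Q p\<close> is
    holomorphic on the whole disc.\<close>
  define Q where "Q = (\<lambda>p::nat. \<lambda>z. if z = of_nat p then deriv F (of_nat p)
     else (F z - F (of_nat p)) / (z - of_nat p))"
  define H where "H = (\<lambda>z. \<Sum>p\<in>I. - of_nat p * c p * Q p z)"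
  have fin: "finite I" unfolding I_def by (rule finite_subset[of _ "{..q}"]) auto
  have "2 \<in> I" using assms by (auto simp: I_def)
  hence ne: "I \<noteq> {}" by auto
  have "F holomorphic_on ball 0 (real q + 1)"
    unfolding F_def using assms by (intro residue_factor_holomorphic) auto
  hence "H holomorphic_on ball 0 (real q + 1)"
    unfolding H_def Q_def by (intro holomorphic_intros pole_lemma_open) auto
  moreover have "nu z = H z + (\<Sum>p\<in>I. of_real (beta p) * inverse (1 - z / of_nat p))"
    if "norm z < 1" for z
  proof -
    have zp: "of_nat p \<noteq> (0::complex)" "z \<noteq> of_nat p" if "p \<in> I" for p
      using that \<open>norm z < 1\<close> prime_ge_1_nat[of p] by (auto simp: I_def)
    have "nu z = F z * (\<Prod>p\<in>I. inverse (1 - z / of_nat p))"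
      unfolding F_def I_def using assms that by (intro nu_eq_residue_factor) auto
    also have "(\<Prod>p\<in>I. inverse (1 - z / of_nat p)) = (\<Sum>p\<in>I. c p *
      inverse (1 - z / of_nat p))"
      unfolding c_def using zp by (intro prod_inverse_partial_fractions fin ne) auto
    also have "F z * \<dots> = (\<Sum>p\<in>I. - of_nat p * c p * Q p z +
        F (of_nat p) * c p * inverse (1 - z / of_nat p))"
      unfolding sum_distrib_left
    proof (intro sum.cong refl)
      fix p assume "p \<in> I"
      note zp = zp[OF this]
      have "1 - z / of_nat p = - (z - of_nat p) / of_nat p" using zp by (simp add: field_simps)
      moreover have "z - of_nat p \<noteq> 0" using zp by simp
      ultimately show "F z * (c p * inverse (1 - z / of_nat p)) = - of_nat p * c p * Q p z +
        F (of_nat p) * c p * inverse (1 - z / of_nat p)"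
        using zp by (simp add: Q_def field_simps)
    qed
    also have "\<dots> = H z + (\<Sum>p\<in>I. of_real (beta p) * inverse (1 - z / of_nat p))"
      unfolding H_def sum.distrib[symmetric]
      by (intro sum.cong refl) (auto simp: beta_eq_residue(2) F_def c_def I_def)
    finally show ?thesis .
  qed
  ultimately show ?thesis using that unfolding I_def by blast
qed

text \<open>Removing the pole at q too makes \<open>H\<close> holomorphic beyond |z| = q, so
  Cauchy's inequality applies at radius exactly q. The extracted term of q has the order of the
  error.\<close>

lemma nu_coeff_bigo:
  assumes "prime q"
  shows "(\<lambda>k. nu_coeff k - (\<Sum>p | prime p \<and> p < q. of_real (beta p) / of_nat p ^ k))
           \<in> O(\<lambda>k. 1 / of_nat q ^ k)"
proof -
  define I where "I = {p. prime p \<and> p \<le> q}"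
  have fin: "finite I" unfolding I_def by (rule finite_subset[of _ "{..q}"]) auto
  obtain H where H: "H holomorphic_on ball 0 (real q + 1)"
    "\<And>z. norm z < 1 \<Longrightarrow> nu z = H z + (\<Sum>p\<in>I. of_real (beta p) *
      inverse (1 - z / of_nat p))"
    using nu_partial_fractions[of q] prime_gt_1_nat[OF assms] unfolding I_def by blast
  define G where "G = (\<Sum>p\<in>I. fps_const (complex_of_real (beta p)) *
      Abs_fps (\<lambda>k. 1 / of_nat p ^ k))"
  have G: "(\<lambda>z. H z + (\<Sum>p\<in>I. of_real (beta p) * inverse (1 - z / of_nat p)))
          has_fps_expansion (fps_expansion H 0 + G)"
    unfolding G_def
    by (intro has_fps_expansion_add has_fps_expansion_sum has_fps_expansion_cmult_left
          has_fps_expansion_geometric has_fps_expansion_fps_expansion[OF _ _ H(1)])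
       (auto simp: I_def prime_gt_0_nat)
  have "eventually (\<lambda>z. z \<in> ball 0 1) (nhds (0::complex))"
    by (intro eventually_nhds_in_open) auto
  hence "eventually (\<lambda>z. nu z = H z + (\<Sum>p\<in>I. of_real (beta p) *
      inverse (1 - z / of_nat p)))
           (nhds 0)" by eventually_elim (use H(2) in auto)
  hence "nu has_fps_expansion (fps_expansion H 0 + G)"
    using has_fps_expansion_cong[THEN iffD2, OF _ refl G] by blast
  hence nc: "nu_coeff k = (deriv ^^ k) H 0 / fact k + (\<Sum>p\<in>I. of_real (beta p) / of_nat p ^ k)" for k
    unfolding nu_coeff_def using fps_nth_fps_expansion[of nu "fps_expansion H 0 + G" k]
    unfolding G_def fps_add_nth fps_sum_nth by (simp add: fps_expansion_def)
  have I: "I = insert q {p. prime p \<and> p < q}" "q \<notin> {p. prime p \<and> p < q}"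
    using assms by (auto simp: I_def)
  hence "finite {p. prime p \<and> p < q}" using fin by simp
  hence "nu_coeff k - (\<Sum>p | prime p \<and> p < q. of_real (beta p) / of_nat p ^ k) =
      (deriv ^^ k) H 0 / fact k + of_real (beta q) * (1 / of_nat q ^ k)" for k
    unfolding nc I(1) using I(2) by simp
  moreover have "(\<lambda>k. (deriv ^^ k) H 0 / fact k) \<in> O(\<lambda>k. 1 / of_real (real q) ^ k)"
    using prime_gt_0_nat[OF assms] by (intro Taylor_coeff_bigo[OF H(1)]) auto
  moreover have "(\<lambda>k. complex_of_real (beta q) *
      (1 / of_nat q ^ k)) \<in> O(\<lambda>k. 1 / of_nat q ^ k)"
    by (intro bigoI[where c = "\<bar>beta q\<bar>"]) (simp add: norm_divide norm_power)
  ultimately show ?thesis by (simp add: sum_in_bigo)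
qed

section \<open>Sums over rough numbers\<close>

definition rough :: "nat \<Rightarrow> nat \<Rightarrow> bool" where
  "rough k n \<longleftrightarrow> n > 0 \<and> (\<forall>p. prime p \<longrightarrow> p < k \<longrightarrow> \<not> p dvd n)"

text \<open>This is zeta(s) without the Euler factors of the primes below k: zeta(s) itself at k =
  0, with limit 1 as k grows.\<close>

definition rough_sum :: "nat \<Rightarrow> nat \<Rightarrow> real" where
  "rough_sum s k = (\<Sum>n. if rough k n then 1 / real n ^ s else 0)"

lemma summable_inverse_power:
  assumes "2 \<le> s"
  shows "summable (\<lambda>n. 1 / real n ^ s)"
  using inverse_power_summable[OF assms, where 'a = real] by (simp add: divide_inverse)

lemma summable_rough:
  assumes "2 \<le> s"
  shows "summable (\<lambda>n. if rough k n then 1 / real n ^ s else 0)"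
  by (intro summable_comparison_test[OF _ summable_inverse_power[OF assms]]) auto

lemma rough_Suc: "rough (Suc k) n \<longleftrightarrow> rough k n \<and> \<not> (prime k \<and> k dvd n)"
  by (auto simp: rough_def less_Suc_eq)

lemma rough_mult:
  assumes "prime k"
  shows "rough k (k * m) \<longleftrightarrow> rough k m"
proof -
  have "\<not> p dvd k" if "prime p" "p < k" for p
    using that assms primes_dvd_imp_eq by blast
  thus ?thesis using prime_gt_0_nat[OF assms] by (auto simp: rough_def prime_dvd_mult_iff)
qed

text \<open>One step of the sieve of Eratosthenes: for k prime, the \<open>rough k\<close> multiples
  of k are the \<open>k * m\<close> with m again \<open>rough k\<close>, and they carry the fraction
  \<open>1 / k ^ s\<close> of the sum.\<close>

lemma rough_sum_Suc:
  assumes "2 \<le> s"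
  shows "rough_sum s (Suc k) = (if prime k then 1 - 1 / real k ^ s else 1) * rough_sum s k"
proof (cases "prime k")
  case True
  define f where "f = (\<lambda>k n. if rough k n then 1 / real n ^ s else 0)"
  define g where "g = (\<lambda>n. if k dvd n then f k n else 0)"
  have "f k (k * m) = 1 / real k ^ s * f k m" for m
    using rough_mult[OF True] by (simp add: f_def power_mult_distrib)
  moreover have "(\<lambda>m. 1 / real k ^ s * f k m) sums (1 / real k ^ s * rough_sum s k)"
    unfolding f_def rough_sum_def by (intro sums_mult summable_sums summable_rough assms)
  ultimately have "(\<lambda>m. g (k * m)) sums (1 / real k ^ s *
      rough_sum s k)" by (simp add: g_def)
  moreover have "strict_mono (\<lambda>m. k *
      m)" using prime_gt_0_nat[OF True] by (auto simp: strict_mono_def)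
  moreover have "g n = 0" if "n \<notin> range (\<lambda>m. k * m)" for n
    using that by (auto simp: g_def elim!: dvdE)
  ultimately have "g sums (1 / real k ^ s * rough_sum s k)"
    using sums_mono_reindex[of "\<lambda>m. k * m" g] by blast
  moreover have "f k sums rough_sum s k"
    unfolding f_def rough_sum_def by (intro summable_sums summable_rough assms)
  ultimately have "(\<lambda>n. f k n - g n) sums (rough_sum s k - 1 / real k ^ s * rough_sum s k)"
    by (intro sums_diff)
  also have "(\<lambda>n. f k n - g n) = f (Suc k)"
    using True by (auto simp: f_def g_def rough_Suc fun_eq_iff)
  finally show ?thesis using True sums_unique[of "f (Suc k)"]
    by (simp add: rough_sum_def f_def algebra_simps)
next
  case False
  thus ?thesis by (simp add: rough_sum_def rough_Suc)
qed

lemma rough_sum_eq_prod: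
  assumes "2 \<le> s"
  shows "rough_sum s k = (\<Sum>n. 1 / real n ^ s) *
      (\<Prod>i<k. if prime i then 1 - 1 / real i ^ s else 1)"
proof (induction k)
  case 0
  \<comment> \<open>The index 0 is not rough, but \<open>1 / 0 ^ s\<close> is 0 by
    convention.\<close>
  have "(if rough 0 n then 1 / real n ^ s else 0) = 1 / real n ^ s" for n
    using assms by (auto simp: rough_def)
  thus ?case by (simp add: rough_sum_def)
qed (simp add: rough_sum_Suc[OF assms])

text \<open>For k > 1 the only rough number below k is 1, so the sum exceeds 1 by at most the tail
  of the zeta series from k on.\<close>

lemma rough_sum_tendsto:
  assumes "2 \<le> s"
  shows "rough_sum s \<longlonglongrightarrow> 1"
proof -
  define f where "f = (\<lambda>n. 1 / real n ^ s)"
  have f: "summable f" unfolding f_def by (rule summable_inverse_power[OF assms])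
  have b: "1 \<le> rough_sum s k \<and> rough_sum s k \<le> 1 + (suminf f - sum f {..<k})" if "1 < k" for k
  proof -
    define g where "g = (\<lambda>n. if rough k n then f n else 0)"
    have g: "summable g" unfolding g_def f_def by (rule summable_rough[OF assms])
    have r1: "rough k 1" by (auto simp: rough_def)
    have "(\<Sum>n<k. g n) = (\<Sum>n<k. if n = 1 then 1 else 0)"
    proof (intro sum.cong refl)
      fix n assume n: "n \<in> {..<k}"
      have "\<not> rough k n" if "n \<noteq> 1"
      proof
        assume "rough k n"
        obtain p where "prime p" "p dvd n" using prime_factor_nat \<open>n \<noteq> 1\<close> by blast
        moreover have "p \<le> n" using \<open>rough k n\<close> \<open>p dvd n\<close> by (auto simp: rough_def intro: dvd_imp_le)
        ultimately show False using n \<open>rough k n\<close> by (auto simp: rough_def)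
      qed
      thus "g n = (if n = 1 then 1 else 0)" using r1 by (auto simp: g_def f_def)
    qed
    also have "\<dots> = 1" using that by simp
    finally have s: "(\<Sum>n<k. g n) = 1" .
    have "rough_sum s k = suminf g"
      unfolding rough_sum_def g_def f_def by (rule refl)
    hence r: "rough_sum s k = (\<Sum>n. g (n + k)) + 1"
      using suminf_split_initial_segment[OF g, of k] s by simp
    have gf: "0 \<le> g n" "g n \<le> f n" for n by (auto simp: g_def f_def)
    note shift = summable_iff_shift[THEN iffD2, OF g, of k] summable_iff_shift[THEN iffD2, OF f, of k]
    have "0 \<le> (\<Sum>n. g (n + k))" by (intro suminf_nonneg shift gf)
    moreover have "(\<Sum>n. g (n + k)) \<le> (\<Sum>n. f (n + k))" by (intro suminf_le shift gf)
    moreover have "(\<Sum>n. f (n + k)) = suminf f - sum f {..<k}"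
      using suminf_minus_initial_segment[OF f] by simp
    ultimately show ?thesis using r by linarith
  qed
  have "(\<lambda>k. sum f {..<k}) \<longlonglongrightarrow> suminf f" using f by (rule summable_LIMSEQ)
  hence "(\<lambda>k. 1 + (suminf f - sum f {..<k})) \<longlonglongrightarrow> 1 + (suminf f - suminf f)"
    by (intro tendsto_intros)
  hence "(\<lambda>k. 1 + (suminf f - sum f {..<k})) \<longlonglongrightarrow> 1" by simp
  thus ?thesis
    by (rule tendsto_sandwich[rotated 2, OF tendsto_const])
       (use b in \<open>auto intro!: eventually_mono[OF eventually_gt_at_top[of 1]]\<close>)
qed

section \<open>Bounds for zeta values\<close>

text \<open>The tail from \<open>M\<close> on is compared termwise with a telescoping series of sum
  \<open>g M\<close>; only \<open>c * g M\<close> separates the two bounds.\<close>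

lemma suminf_telescoping_bounds:
  fixes f g :: "nat \<Rightarrow> real"
  assumes "summable f" "g \<longlonglongrightarrow> 0" "0 \<le> c"
    and "\<And>n. M \<le> n \<Longrightarrow> g n - g (Suc n) \<le> f n \<and> f n \<le> (1 + c) * (g n - g (Suc n))"
  shows "sum f {..<M} + g M \<le> suminf f" "suminf f \<le> sum f {..<M} + (1 + c) * g M"
proof -
  have "(\<lambda>n. g (n + M)) \<longlonglongrightarrow> 0" using assms(2) by (rule LIMSEQ_ignore_initial_segment)
  hence t: "(\<lambda>n. g (n + M) - g (Suc (n + M))) sums g M"
    using telescope_sums'[of "\<lambda>n. g (n + M)" 0] by simp
  have s: "summable (\<lambda>n. f (n + M))" using assms(1) by (simp add: summable_iff_shift)
  have *: "suminf f = (\<Sum>n. f (n + M)) + sum f {..<M}"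
    by (rule suminf_split_initial_segment[OF assms(1)])
  have "g M \<le> (\<Sum>n. f (n + M))"
    using assms(4) by (intro sums_le[OF _ t summable_sums[OF s]]) auto
  moreover have "(\<Sum>n. f (n + M)) \<le> (1 + c) * g M"
    using assms(4) by (intro sums_le[OF _ summable_sums[OF s] sums_mult[OF t]]) auto
  ultimately show "sum f {..<M} + g M \<le> suminf f" "suminf f \<le> sum f {..<M} + (1 + c) * g M"
    using * by linarith+
qed

text \<open>
  With \<open>x = n - 1/2\<close>, the telescoping terms below are \<open>1 / (x + 1 / (12 x))\<close>,
  \<open>1 / (2 (x\<^sup>2 + 1/4))\<close> and \<open>1 / (3 (x\<^sup>3 + x / 2))\<close>.  They agree with the Euler-Maclaurin expansion
  of the tail up to second order, and the relative error of the differences is of order \<open>n\<^sup>-\<^sup>4\<close>.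
\<close>

lemma zeta2_term_bounds:
  fixes n :: real
  assumes "30 \<le> n"
  defines "d \<equiv> (6*n-3)/(6*n^2-6*n+2) - (6*(n+1)-3)/(6*(n+1)^2-6*(n+1)+2)"
  shows "d \<le> 1 / n^2" "1 / n^2 \<le> (1 + 1/6480000) * d"
proof -
  \<comment> \<open>The product of the two denominators is \<open>4 * D\<close>, and
    \<open>d * n^2 = (D - 1) / D\<close>. The constant 6480000 is \<open>8 * 30^4\<close>, a lower
    bound for \<open>D - 1\<close>.\<close>
  define D where "D = 9*n^4 - 3*n^2 + 1"
  have n2: "900 \<le> n^2" using power_mono[OF assms(1), of 2] by simp
  have nn: "30 *
      n \<le> n^2" unfolding power2_eq_square using assms(1) by (intro mult_right_mono) auto
  have n4: "n^4 = n^2 * n^2" by (simp flip: power_add)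
  have n4': "810000 \<le> n^4" using power_mono[OF assms(1), of 4] by simp
  have n42: "900 * n^2 \<le> n^4" unfolding n4 using n2 by (intro mult_right_mono) auto
  have D: "D > 0" "D - 1 \<ge> 6480000" using n4' n42 by (simp_all add: D_def)
  have 1: "6*n^2-6*n+2 > 0" "6*n^2+6*n+2 > 0"
    using assms(1) n2 nn by linarith+
  have e: "6*(n+1)^2-6*(n+1)+2 = 6*n^2+6*n+2" "6*(n+1)-3 = 6*n+3"
    by (simp_all add: power2_eq_square algebra_simps)
  have "d = ((6*n-3)*(6*n^2+6*n+2) - (6*n+3)*(6*n^2-6*n+2)) / ((6*n^2-6*n+2)*(6*n^2+6*n+2))"
    unfolding d_def e using 1 by (simp add: diff_frac_eq)
  also have "(6*n-3)*(6*n^2+6*n+2) - (6*n+3)*(6*n^2-6*n+2) = 4 * (9*n^2-3)"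
    by (simp add: algebra_simps power2_eq_square)
  also have "(6*n^2-6*n+2)*(6*n^2+6*n+2) = 4 * D"
    by (simp add: D_def algebra_simps power2_eq_square power4_eq_xxxx)
  also have "4 * (9*n^2-3) / (4 * D) = (9*n^2-3) / D" by (rule mult_divide_mult_cancel_left) simp
  also have "\<dots> = (D - 1) / D / n^2"
    using assms(1) n2 D unfolding D_def n4 by (simp add: divide_simps) (simp add: algebra_simps)
  finally have d: "d = (D - 1) / D / n^2" .
  show "d \<le> 1 / n^2" unfolding d using D by (intro divide_right_mono) auto
  have "D \<le> (1 + 1/6480000) * (D - 1)" using D by simp
  hence "1 \<le> (1 + 1/6480000) * (D - 1) / D" using D by simp
  hence "1 / n^2 \<le> (1 + 1/6480000) * (D - 1) / D / n^2" by (intro divide_right_mono) auto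
  thus "1 / n^2 \<le> (1 + 1/6480000) * d" by (simp only: d times_divide_eq_right)
qed

lemma zeta3_term_bounds:
  fixes n :: real
  assumes "30 \<le> n"
  defines "d \<equiv> 1/(2*n^2-2*n+1) - 1/(2*(n+1)^2-2*(n+1)+1)"
  shows "d \<le> 1 / n^3" "1 / n^3 \<le> (1 + 1/3240000) * d"
proof -
  have n2: "900 \<le> n^2" using power_mono[OF assms(1), of 2] by simp
  have nn: "30 *
      n \<le> n^2" unfolding power2_eq_square using assms(1) by (intro mult_right_mono) auto
  have n4: "810000 \<le> n^4" using power_mono[OF assms(1), of 4] by simp
  have n3: "0 < n^3" using assms(1) by simp
  have 1: "2*n^2-2*n+1 > 0" "2*n^2+2*n+1 > 0"
    using assms(1) n2 nn by linarith+
  have e: "2*(n+1)^2-2*(n+1)+1 = 2*n^2+2*n+1"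
    by (simp_all add: power2_eq_square algebra_simps)
  have "d = ((2*n^2+2*n+1) - (2*n^2-2*n+1)) / ((2*n^2-2*n+1)*(2*n^2+2*n+1))"
    unfolding d_def e using 1 by (simp add: diff_frac_eq)
  also have "(2*n^2-2*n+1)*(2*n^2+2*n+1) = 4*n^4 + 1"
    by (simp add: algebra_simps power2_eq_square power4_eq_xxxx)
  also have "(2*n^2+2*n+1) - (2*n^2-2*n+1) = 4 * n" by simp
  also have "4 * n / (4*n^4+1) = (4*n^4) / (4*n^4+1) / n^3"
    using assms(1) by (simp add: power3_eq_cube power4_eq_xxxx)
  finally have d: "d = (4*n^4) / (4*n^4+1) / n^3" .
  have "4*n^4 / (4*n^4+1) \<le> 1" using n4 by (simp add: divide_simps)
  thus "d \<le> 1 / n^3" unfolding d using n3 by (intro divide_right_mono) auto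
  \<comment> \<open>The constant 3240000 is \<open>4 * 30^4\<close>.\<close>
  have "4*n^4 + 1 \<le> (1 + 1/3240000) * (4*n^4)" using n4 by simp
  hence "1 \<le> (1 + 1/3240000) * (4*n^4) / (4*n^4+1)" using n4 by simp
  hence "1 / n^3 \<le> (1 + 1/3240000) *
      (4*n^4) / (4*n^4+1) / n^3" using n3 by (intro divide_right_mono) auto
  thus "1 / n^3 \<le> (1 + 1/3240000) * d" by (simp only: d times_divide_eq_right)
qed

lemma zeta4_term_bounds:
  fixes n :: real
  assumes "30 \<le> n"
  defines "d \<equiv> 1/(3*(n-1/2)^3+3/2*(n-1/2)) - 1/(3*(n+1-1/2)^3+3/2*(n+1-1/2))"
  shows "d \<le> 1 / n^4" "1 / n^4 \<le> (1 + 1/1620000) * d"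
proof -
  define a b where "a = 3*(n-1/2)^3+3/2*(n-1/2)" and "b = 3*(n+1/2)^3+3/2*(n+1/2)"
  \<comment> \<open>Here \<open>d * n^4 = N / D\<close>. The excess \<open>D - N\<close> is below
    \<open>n^2 / 2\<close>, while \<open>N\<close> is at least \<open>n^6\<close>; the constant
    1620000 is \<open>2 * 30^4\<close>.\<close>
  define N D where "N = n^6 + n^4/4" and "D = N + 7*n^2/16 - 9/64"
  have ab: "a > 0" "b > 0" unfolding a_def b_def using assms(1) by (intro add_pos_pos; simp)+
  have n2: "900 \<le> n^2" using power_mono[OF assms(1), of 2] by simp
  have n4: "810000 \<le> n^4" using power_mono[OF assms(1), of 4] by simp
  have n6: "n^6 = n^4 * n^2" by (simp flip: power_add)
  have n62: "810000 * n^2 \<le> n^6" unfolding n6 using n4 by (intro mult_right_mono) auto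
  have e: "n + 1 - 1/2 = n + 1/2" by simp
  have "d = (b - a) / (a * b)"
    unfolding d_def e a_def[symmetric] b_def[symmetric] using ab by (simp add: diff_frac_eq)
  also have "b - a = 9 * (n^2 + 1/4)"
    by (simp add: a_def b_def power2_eq_square power3_eq_cube algebra_simps add_divide_distrib diff_divide_distrib)
  also have "a * b = 9 * D"
    unfolding a_def b_def D_def N_def n6
    by (simp add: power2_eq_square power3_eq_cube power4_eq_xxxx algebra_simps add_divide_distrib diff_divide_distrib)
  also have "9 * (n^2 + 1/4) / (9 *
      D) = (n^2 + 1/4) / D" by (rule mult_divide_mult_cancel_left) simp
  also have "(n^2 + 1/4) / D = n^4 * (n^2 + 1/4) / D / n^4" using assms(1) by simp
  also have "n^4 *
      (n^2 + 1/4) = N" by (simp only: N_def n6 distrib_left times_divide_eq_right mult_1_right)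
  finally have d: "d = N / D / n^4" .
  have D: "D > 0" "N \<le> D" "D \<le> (1 + 1/1620000) * N"
    using n2 n4 n62 by (simp_all add: D_def N_def)
  have "N / D \<le> 1" using D by simp
  thus "d \<le> 1 / n^4" unfolding d using n4 by (intro divide_right_mono) auto
  have "1 \<le> (1 + 1/1620000) * N / D" using D by simp
  hence "1 / n^4 \<le> (1 + 1/1620000) * N / D / n^4" using n4 by (intro divide_right_mono) auto
  thus "1 / n^4 \<le> (1 + 1/1620000) * d" by (simp only: d times_divide_eq_right)
qed

text \<open>Partial sums can be evaluated in integers at scale \<open>C\<close>: each truncated
  division loses at most 1.\<close>

lemma sum_div_power_bounds:
  assumes "0 < s"
  shows "real (\<Sum>n<M. C div n ^ s) \<le> real C * (\<Sum>n<M. 1 / real n ^ s)"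
    and "real C * (\<Sum>n<M. 1 / real n ^ s) \<le> real (\<Sum>n<M. C div n ^ s) + real M"
proof -
  have "real (C div n ^ s) \<le> real C / real n ^ s" for n
    using of_nat_div_le_of_nat[of C "n ^ s", where 'a = real] by simp
  thus "real (\<Sum>n<M. C div n ^ s) \<le> real C * (\<Sum>n<M. 1 / real n ^ s)"
    by (simp add: sum_distrib_left sum_mono)
  have "real C / real n ^ s \<le> real (C div n ^ s) + 1" for n
    using floor_divide_of_nat_eq[of C "n ^ s", where 'a = real]
      real_of_int_floor_add_one_ge[of "real C / real (n ^ s)"] by simp
  hence "(\<Sum>n<M. real C / real n ^ s) \<le> (\<Sum>n<M. real (C div n ^ s) + 1)"
    by (rule sum_mono)
  thus "real C * (\<Sum>n<M. 1 / real n ^ s) \<le> real (\<Sum>n<M. C div n ^ s) + real M"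
    by (simp add: sum_distrib_left sum.distrib)
qed

lemma zeta2_bounds:
  "1.64493406585 \<le> (\<Sum>n. 1 / real n ^ 2)" "(\<Sum>n. 1 / real n ^ 2) \<le> 1.64493407109"
proof -
  define g where "g = (\<lambda>n::nat. (6*real n-3)/(6*real n^2-6*real n+2))"
  have lim: "g \<longlonglongrightarrow> 0" unfolding g_def by real_asymp
  have d: "g n - g (Suc n) \<le> 1 / real n ^ 2 \<and> 1 / real n ^ 2 \<le> (1 + 1/6480000) *
      (g n - g (Suc n))"
    if "30 \<le> n" for n
    using zeta2_term_bounds[of "real n"] that by (simp add: g_def add.commute)
  \<comment> \<open>At this scale truncation costs at most \<open>30 / 10^13\<close>; the width of
    the final interval comes almost entirely from \<open>g 30 / 6480000\<close>.\<close>
  have "(\<Sum>n<30. 10 ^ 13 div n ^ 2 :: nat) = 16110390064895"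
    by (simp add: lessThan_nat_numeral)
  hence "16110390064895 \<le> 10 ^ 13 * (\<Sum>n<30. 1 / real n ^ 2)" "10 ^ 13 *
      (\<Sum>n<30. 1 / real n ^ 2) \<le> 16110390064895 + 30"
    using sum_div_power_bounds[of 2 "10 ^ 13" 30] by simp_all
  moreover have "g 30 = 177 / 5222" by (simp add: g_def power_divide eval_nat_numeral)
  ultimately show "1.64493406585 \<le> (\<Sum>n. 1 / real n ^ 2)" "(\<Sum>n. 1 / real n ^ 2) \<le> 1.64493407109"
    using suminf_telescoping_bounds[OF summable_inverse_power lim _ d, of 30] by simp_all
qed

lemma zeta3_bounds:
  "1.20205690309 \<le> (\<Sum>n. 1 / real n ^ 3)" "(\<Sum>n. 1 / real n ^ 3) \<le> 1.20205690328"
proof -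
  define g where "g = (\<lambda>n::nat. 1/(2*real n^2-2*real n+1))"
  have lim: "g \<longlonglongrightarrow> 0" unfolding g_def by real_asymp
  have d: "g n - g (Suc n) \<le> 1 / real n ^ 3 \<and> 1 / real n ^ 3 \<le> (1 + 1/3240000) *
      (g n - g (Suc n))"
    if "30 \<le> n" for n
    using zeta3_term_bounds[of "real n"] that by (simp add: g_def add.commute)
  have "(\<Sum>n<30. 10 ^ 13 div n ^ 3 :: nat) = 12014825205568"
    by (simp add: lessThan_nat_numeral)
  hence "12014825205568 \<le> 10 ^ 13 * (\<Sum>n<30. 1 / real n ^ 3)" "10 ^ 13 *
      (\<Sum>n<30. 1 / real n ^ 3) \<le> 12014825205568 + 30"
    using sum_div_power_bounds[of 3 "10 ^ 13" 30] by simp_all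
  moreover have "g 30 = 1 / 1741" by (simp add: g_def power_divide eval_nat_numeral)
  ultimately show "1.20205690309 \<le> (\<Sum>n. 1 / real n ^ 3)" "(\<Sum>n. 1 / real n ^ 3) \<le> 1.20205690328"
    using suminf_telescoping_bounds[OF summable_inverse_power lim _ d, of 30] by simp_all
qed

lemma zeta4_bounds:
  "1.08232323370 \<le> (\<Sum>n. 1 / real n ^ 4)" "(\<Sum>n. 1 / real n ^ 4) \<le> 1.08232323372"
proof -
  define g where "g = (\<lambda>n::nat. 1/(3*(real n-1/2)^3+3/2*(real n-1/2)))"
  have lim: "g \<longlonglongrightarrow> 0" unfolding g_def by real_asymp
  have d: "g n - g (Suc n) \<le> 1 / real n ^ 4 \<and> 1 / real n ^ 4 \<le> (1 + 1/1620000) *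
      (g n - g (Suc n))"
    if "30 \<le> n" for n
    using zeta4_term_bounds[of "real n"] that by (simp add: g_def add.commute)
  have "(\<Sum>n<30. 10 ^ 13 div n ^ 4 :: nat) = 10823102570371"
    by (simp add: lessThan_nat_numeral)
  hence "10823102570371 \<le> 10 ^ 13 * (\<Sum>n<30. 1 / real n ^ 4)" "10 ^ 13 *
      (\<Sum>n<30. 1 / real n ^ 4) \<le> 10823102570371 + 30"
    using sum_div_power_bounds[of 4 "10 ^ 13" 30] by simp_all
  moreover have "g 30 = 8 / 616491" by (simp add: g_def power_divide eval_nat_numeral)
  ultimately show "1.08232323370 \<le> (\<Sum>n. 1 / real n ^ 4)" "(\<Sum>n. 1 / real n ^ 4) \<le> 1.08232323372"
    using suminf_telescoping_bounds[OF summable_inverse_power lim _ d, of 30] by simp_all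
qed

section \<open>The twin prime product\<close>

text \<open>
  Multiplying the factors of the twin prime product by those of the Euler products of
  \<open>1 / \<zeta>(2)\<close>, \<open>1 / \<zeta>(3)\<^sup>2\<close> and \<open>1 / \<zeta>(4)\<^sup>3\<close> leaves factors \<open>1 + O(p\<^sup>-\<^sup>5)\<close>, so that the
  primes below 60 determine the product to the required accuracy.  The factor of the twin prime
  product at 2 is replaced by 1.
\<close>

definition accel :: "nat \<Rightarrow> real" where
  "accel p = (if p = 2 then 1 else (1 - 1 / real p)\<^sup>2 / (1 - 2 / real p)) *
     (1 - 1 / real p ^ 2) * (1 - 1 / real p ^ 3) ^ 2 * (1 - 1 / real p ^ 4) ^ 3"

text \<open>With t = 1/p, \<open>N / (1 - 2*t)\<close> is \<open>accel p\<close>. The first two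
  factors give \<open>1 - 2*t + 2*t^3 - t^4\<close>; \<open>(1 - t^3)^2\<close> cancels the cubic
  term and leaves \<open>3*t^4\<close>, which \<open>(1 - t^4)^3\<close> cancels. So
  \<open>N\<close> is \<open>1 - 2*t + 6*t^5\<close> up to higher powers, and 7 in place of 6
  absorbs these.\<close>

lemma accel_poly_bounds:
  fixes t :: real
  assumes "0 \<le> t" "t \<le> 1/60"
  defines "N \<equiv> (1 - t)^2 * (1 - t^2) * (1 - t^3)^2 * (1 - t^4)^3"
  shows "1 - 2*t \<le> N" "N * (1 - 7 * t^5) \<le> 1 - 2*t"
proof -
  have t: "0 \<le> t ^ k" "t ^ k \<le> 1" for k using assms by (auto intro: power_le_one)
  \<comment> \<open>Each further power is at least sixty times smaller, so the estimates below
    become linear in the powers of t.\<close>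
  have s: "t ^ Suc k \<le> t ^ k / 60" for k
    using mult_right_mono[OF assms(2) t(1)[of k]] by simp
  have t5: "t ^ 6 \<le> t ^ 5 / 60" "t ^ 7 \<le> t ^ 6 / 60" "t ^ 8 \<le> t ^ 7 / 60" "t ^ 9 \<le> t ^ 8 / 60"
    "t ^ 10 \<le> t ^ 9 / 60" "t ^ 11 \<le> t ^ 10 / 60" "t ^ 12 \<le> t ^ 11 / 60"
    using s[of 5] s[of 6] s[of 7] s[of 8] s[of 9] s[of 10] s[of 11] by simp_all
  have t4: "t ^ 5 \<le> t ^ 4 / 60" "t ^ 4 \<le> t ^ 3 / 60" "t ^ 3 \<le> t ^ 2 / 60" "t ^ 2 \<le> t / 60"
    using s[of 4] s[of 3] s[of 2] s[of 1] by (simp_all add: power2_eq_square)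
  note pos = t(1)[of 2] t(1)[of 3] t(1)[of 4] t(1)[of 5] t(1)[of 6] t(1)[of 7] t(1)[of 8]
    t(1)[of 9] t(1)[of 10] t(1)[of 11] t(1)[of 12]
  define a where "a = (1 - t)^2 * (1 - t^2)"
  have a0: "0 \<le> a" unfolding a_def using t by simp
  have ae: "a = 1 - 2*t + 2*t^3 - t^4"
    by (simp add: a_def algebra_simps power2_eq_square power3_eq_cube power4_eq_xxxx)
  have b: "1 - 2*t^3 \<le> (1 - t^3)^2" "(1 - t^3)^2 = 1 - 2*t^3 + t^6"
    by (simp_all add: power2_diff flip: power_mult)
  have ce: "(1 - t^4)^3 = 1 - 3*t^4 + 3*t^8 - t^12"
    by (simp add: power3_eq_cube algebra_simps flip: power_add)
  have c: "1 - 3*t^4 \<le> (1 - t^4)^3" "(1 - t^4)^3 \<le> 1 - 3*t^4 + 3*t^8" "0 \<le> (1 - t^4)^3"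
    unfolding ce using t5 pos t4 assms by (simp_all, linarith+)
  have ab: "a * (1 - 2*t^3) = 1 - 2*t + 3*t^4 - 4*t^6 + 2*t^7"
    unfolding ae by algebra
  have ab0: "0 \<le> 1 - 2*t + 3*t^4 - 4*t^6 + 2*t^7" using t5 t4 pos assms by linarith
  have c0: "0 \<le> 1 - 3 * t^4" using t5 t4 pos assms by linarith
  have "1 - 2*t \<le> 1 - 2*t + 6*t^5 - 4*t^6 + 2*t^7 - 9*t^8 + 12*t^10 - 6*t^11"
    using t5 pos by linarith
  also have "\<dots> = (1 - 2*t + 3*t^4 - 4*t^6 + 2*t^7) * (1 - 3*t^4)"
    by algebra
  also have "\<dots> = a * (1 - 2*t^3) * (1 - 3*t^4)" by (simp only: ab)
  also have "\<dots> \<le> N"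
    unfolding N_def a_def[symmetric] using a0 c c0 ab0
    by (intro mult_mono mult_left_mono[OF b(1)] mult_nonneg_nonneg) (simp_all add: ab)
  finally show "1 - 2*t \<le> N" .
  have "a * (1 - t^3)^2 = 1 - 2*t + 3*t^4 - 3*t^6 + 2*t^9 - t^10"
    unfolding b(2) ae by algebra
  also have "\<dots> \<le> 1 - 2*t + 3*t^4" using t5 pos by linarith
  finally have ab': "a * (1 - t^3)^2 \<le> 1 - 2*t + 3*t^4" .
  have d0: "0 \<le> 1 - 7 * t^5" using t5 t4 pos assms by linarith
  have "N \<le> (1 - 2*t + 3*t^4) * (1 - 3*t^4 + 3*t^8)"
    unfolding N_def a_def[symmetric] using ab' c a0 ab0 t4 pos assms
    by (intro mult_mono) (auto, linarith?)
  also have "\<dots> = 1 - 2*t + 6*t^5 - 6*t^8 - 6*t^9 + 9*t^12"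
    by algebra
  also have "\<dots> \<le> 1 - 2*t + 6*t^5" using t5 pos by linarith
  finally have "N * (1 - 7 * t^5) \<le> (1 - 2*t + 6*t^5) * (1 - 7 * t^5)"
    using d0 by (rule mult_right_mono)
  also have "\<dots> = 1 - 2*t - t^5 + 14*t^6 - 42*t^10"
    by algebra
  also have "\<dots> \<le> 1 - 2*t" using t5 pos by linarith
  finally show "N * (1 - 7 * t^5) \<le> 1 - 2*t" .
qed

lemma accel_bounds:
  assumes "60 \<le> p"
  shows "1 \<le> accel p" "accel p * (1 - 7 / real p ^ 5) \<le> 1"
proof -
  define t where "t = 1 / real p"
  have t: "0 \<le> t" "t \<le> 1/60" using assms by (auto simp: t_def field_simps)
  have e: "accel p = (1 - t)^2 * (1 - t^2) * (1 - t^3)^2 * (1 - t^4)^3 / (1 - 2 * t)"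
    using assms by (simp add: accel_def t_def power_divide)
  have t5: "7 / real p ^ 5 = 7 * t^5" by (simp add: t_def power_divide)
  show "1 \<le> accel p" "accel p * (1 - 7 / real p ^ 5) \<le> 1"
    unfolding e t5 using accel_poly_bounds[OF t] t by (simp_all add: field_simps)
qed

text \<open>Integral comparison in telescoped form: \<open>1 / i^5\<close> is at most the drop of
  \<open>1 / (4 * x^4)\<close> from x = i - 1 to x = i. The constant 48469444 is
  \<open>4 * 59^4\<close>, which makes K = 60 an equality.\<close>

lemma sum_inverse_fifth_power_le:
  assumes "60 \<le> K"
  shows "(\<Sum>i=60..<K. 7 / real i ^ 5) \<le> 7 / 48469444 - 7 / (4 * (real K - 1) ^ 4)"
  using assms
proof (induction K rule: dec_induct)
  case base
  show ?case by simp
next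
  case (step K)
  define j where "j = real K - 1"
  have j: "j \<ge> 59" "real K = j + 1" using step.hyps by (simp_all add: j_def)
  have eqs: "real K - 1 = j" "real (Suc K) - 1 = j + 1" "real K = j + 1" by (simp_all add: j_def)
  define x y where "x = j ^ 4" and "y = (j + 1) ^ 4"
  have xy: "0 < x" "0 < y" "0 < j + 1" using j by (simp_all add: x_def y_def)
  \<comment> \<open>The left side consists of the first two binomial terms of
    \<open>(j + 1)^5\<close>.\<close>
  have "(j + 5) * x \<le> (j + 1) * y"
    using j by (simp add: x_def y_def eval_nat_numeral algebra_simps)
  hence "4 * x \<le> (j + 1) * (y - x)" by (simp add: algebra_simps)
  hence "4 * x / (4 * x * ((j + 1) * y)) \<le> (j + 1) * (y - x) / (4 * x * ((j + 1) * y))"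
    using xy by (intro divide_right_mono) auto
  also have "\<dots> = (y - x) / (4 * x * y)" using xy by simp
  also have "\<dots> = 1 / (4 * x) - 1 / (4 * y)" using xy by (simp add: diff_divide_distrib)
  also have "4 * x / (4 * x * ((j + 1) * y)) = 1 / ((j + 1) * y)" using xy by simp
  also have "(j + 1) * y = (j + 1) ^ 5" by (simp add: y_def eval_nat_numeral)
  finally have "1 / (j + 1) ^ 5 \<le> 1 / (4 * j ^ 4) - 1 / (4 * (j + 1) ^ 4)"
    unfolding x_def y_def .
  hence "7 / real K ^ 5 \<le> 7 / (4 * (real K - 1) ^ 4) - 7 / (4 * (real (Suc K) - 1) ^ 4)"
    unfolding eqs by simp
  thus ?case using step by simp
qed

definition accel_prod :: "nat \<Rightarrow> real" where
  "accel_prod K = (\<Prod>i<K. if prime i then accel i else 1)"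

lemma accel_nonneg: "prime i \<Longrightarrow> 0 \<le> accel i"
proof -
  assume "prime i"
  hence "2 \<le> i" by (rule prime_ge_2_nat)
  hence "1 \<le> real i ^ k" for k by (simp add: one_le_power)
  thus "0 \<le> accel i" using \<open>2 \<le> i\<close>
    by (cases "i = 2") (auto simp: accel_def divide_simps)
qed

text \<open>Factors from 60 on are at least 1, hence the first bound. For the second, each times
  \<open>1 - u i\<close> is at most 1, and the product of the \<open>1 - u i\<close> is at least 1
  minus the sum of the \<open>u i\<close>.\<close>

lemma accel_prod_bounds:
  assumes "60 \<le> K"
  shows "accel_prod 60 \<le> accel_prod K" "accel_prod K * (1 - 7 / 48469444) \<le> accel_prod 60"
proof -
  define w where "w = (\<lambda>i. if prime i then accel i else 1)"
  define u where "u = (\<lambda>i::nat. 7 / real i ^ 5)"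
  have split: "accel_prod K = accel_prod 60 * (\<Prod>i=60..<K. w i)"
    unfolding accel_prod_def w_def[symmetric] lessThan_atLeast0
    using assms by (intro prod.atLeastLessThan_concat[symmetric]) auto
  have pos: "0 \<le> accel_prod 60"
    unfolding accel_prod_def by (intro prod_nonneg) (auto simp: accel_nonneg)
  have u: "0 \<le> u i \<and> u i \<le> 1" if "60 \<le> i" for i
  proof -
    have "(60::real) ^ 5 \<le> real i ^ 5" using that by (intro power_mono) auto
    thus ?thesis using that by (simp add: u_def divide_le_eq)
  qed
  have w: "1 \<le> w i" "w i * (1 - u i) \<le> 1" if "60 \<le> i" for i
    using accel_bounds[OF that] u[OF that] by (auto simp: w_def u_def)
  have W1: "1 \<le> (\<Prod>i=60..<K. w i)" using w by (intro prod_ge_1) auto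
  thus "accel_prod 60 \<le> accel_prod K"
    unfolding split using mult_left_mono[OF W1 pos] by simp
  have nn: "0 \<le> 7 / (4 * (real K - 1) ^ 4)" by simp
  have "1 - 7 / 48469444 \<le> 1 - (\<Sum>i=60..<K. u i)"
    using sum_inverse_fifth_power_le[OF assms] nn unfolding u_def by linarith
  also have "\<dots> \<le> (\<Prod>i=60..<K. 1 - u i)"
    using u by (intro Weierstrass_prod_ineq) auto
  finally have "(\<Prod>i=60..<K. w i) * (1 - 7 / 48469444) \<le> (\<Prod>i=60..<K. w i) *
      (\<Prod>i=60..<K. 1 - u i)"
    using W1 by (intro mult_left_mono) auto
  also have "\<dots> = (\<Prod>i=60..<K. w i * (1 - u i))" by (simp add: prod.distrib)
  also have "\<dots> \<le> 1"
  proof (intro prod_le_1 conjI)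
    fix i assume "i \<in> {60..<K}"
    hence "60 \<le> i" by simp
    from u[OF this] w[OF this] show "0 \<le> w i * (1 - u i)" "w i * (1 - u i) \<le> 1" by simp_all
  qed
  finally show "accel_prod K * (1 - 7 / 48469444) \<le> accel_prod 60"
    unfolding split mult.assoc using pos by (rule mult_left_le)
qed

section \<open>The twin prime product as a limit of accelerated products\<close>

lemma twin_prime_factor_eq:
  "(\<lambda>i::nat. if prime i \<and> i \<noteq> 2 then inverse (1 - real 2 / real i) *
      (1 - 1 / real i) ^ 2 else 1) =
   (\<lambda>i. if prime i \<and> 2 < i then (1 - 1 / real i)\<^sup>2 / (1 - 2 / real i) else 1)"
proof (rule ext)
  fix i :: nat
  have "prime i \<and> i \<noteq> 2 \<longleftrightarrow> prime i \<and> 2 < i"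
    using prime_ge_2_nat[of i] by auto
  thus "(if prime i \<and> i \<noteq> 2 then inverse (1 - real 2 / real i) *
      (1 - 1 / real i) ^ 2 else 1) =
   (if prime i \<and> 2 < i then (1 - 1 / real i)\<^sup>2 / (1 - 2 / real i) else 1)"
    by (simp only: of_nat_numeral divide_inverse mult.commute)
qed

text \<open>The prefactor is (1 - 1/2)^2 / 2! = 1/8.\<close>

lemma beta_2_eq:
  "beta 2 = 1 / 8 *
      prime_prod (\<lambda>p. p > 2) (\<lambda>p. (1 - 1 / real p)\<^sup>2 / (1 - 2 / real p))"
  unfolding beta_def prime_prod_def twin_prime_factor_eq
  by (simp add: fact_numeral power2_eq_square)

lemma twin_prime_prod_tendsto:
  "(\<lambda>K. \<Prod>i<K. if prime i \<and> 2 < i then (1 - 1 / real i)\<^sup>2 / (1 - 2 / real i) else 1)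
     \<longlonglongrightarrow> prime_prod (\<lambda>p. p > 2) (\<lambda>p. (1 - 1 / real p)\<^sup>2 / (1 - 2 / real p))"
proof -
  define f where
    "f = (\<lambda>i::nat. if prime i \<and> 2 < i then (1 - 1 / real i)\<^sup>2 / (1 - 2 / real i) else 1)"
  have "convergent_prod f"
    using beta_eq_residue(1)[of 2 2] unfolding twin_prime_factor_eq f_def by simp
  hence "(\<lambda>K. prod f {..K}) \<longlonglongrightarrow> prodinf f" by (rule convergent_prod_LIMSEQ)
  hence "(\<lambda>K. prod f {..<Suc K}) \<longlonglongrightarrow> prodinf f" by (simp only: lessThan_Suc_atMost)
  hence "(\<lambda>K. prod f {..<K}) \<longlonglongrightarrow> prodinf f" by (rule LIMSEQ_imp_Suc)
  thus ?thesis by (simp only: f_def prime_prod_def)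
qed

text \<open>Multiplying the partial twin prime products by powers of \<open>rough_sum\<close>, which
  tend to 1, does not change the limit; each \<open>rough_sum s K\<close> is zeta(s) times a finite
  product that \<open>accel_prod K\<close> absorbs.\<close>

lemma accel_prod_tendsto:
  "(\<lambda>K. accel_prod K * ((\<Sum>n. 1 / real n ^ 2) * (\<Sum>n. 1 / real n ^ 3) ^ 2 *
      (\<Sum>n. 1 / real n ^ 4) ^ 3))
     \<longlonglongrightarrow> prime_prod (\<lambda>p. p > 2) (\<lambda>p. (1 - 1 / real p)\<^sup>2 / (1 - 2 / real p))"
proof -
  define f where "f = (\<lambda>i::nat. if prime i \<and> 2 < i then (1 - 1 / real i)\<^sup>2 / (1 - 2 / real i) else 1)"
  define e where "e = (\<lambda>s (i::nat). if prime i then 1 - 1 / real i ^ s else 1)"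
  have "(\<lambda>K. (\<Prod>i<K. f i) * rough_sum 2 K * rough_sum 3 K ^ 2 * rough_sum 4 K ^ 3)
     \<longlonglongrightarrow> prime_prod (\<lambda>p. p > 2) (\<lambda>p. (1 - 1 / real p)\<^sup>2 / (1 - 2 / real p)) * 1 * 1 ^ 2 * 1 ^ 3"
    unfolding f_def by (intro tendsto_intros twin_prime_prod_tendsto rough_sum_tendsto) auto
  moreover have "(if prime i then accel i else 1) = f i * e 2 i * e 3 i ^ 2 * e 4 i ^ 3" for i
    using prime_ge_2_nat[of i] by (auto simp: f_def e_def accel_def)
  hence "accel_prod K = (\<Prod>i<K. f i) * (\<Prod>i<K. e 2 i) * (\<Prod>i<K. e 3 i) ^ 2 *
      (\<Prod>i<K. e 4 i) ^ 3" for K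
    by (simp add: accel_prod_def prod.distrib prod_power_distrib)
  hence "(\<Prod>i<K. f i) * rough_sum 2 K * rough_sum 3 K ^ 2 * rough_sum 4 K ^ 3 =
     accel_prod K * ((\<Sum>n. 1 / real n ^ 2) * (\<Sum>n. 1 / real n ^ 3) ^ 2 *
      (\<Sum>n. 1 / real n ^ 4) ^ 3)" for K
    by (simp add: rough_sum_eq_prod e_def power_mult_distrib mult_ac)
  ultimately show ?thesis by simp
qed

section \<open>Numerical evaluation\<close>

text \<open>As a single fraction, the value at a numeral reduces to integer arithmetic. The exponent
  is 21 = 1 + 2 + 6 + 12.\<close>

lemma accel_eq:
  assumes "2 < p"
  shows "accel p = ((real p - 1)^2 * (real p^2 - 1) * (real p^3 - 1)^2 * (real p^4 - 1)^3) /
                     (real p ^ 21 * (real p - 2))"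
proof -
  define x where "x = real p"
  have x: "x > 2" using assms by (simp add: x_def)
  have "(1 - 1 / x)\<^sup>2 / (1 - 2 / x) = (x - 1)^2 / (x * (x - 2))"
    using x by (simp add: field_simps power2_eq_square)
  moreover have "1 - 1 / x ^ k = (x ^ k - 1) / x ^ k" for k
    using x by (simp add: diff_divide_distrib)
  ultimately have "accel p = (x - 1)^2 / (x * (x - 2)) * ((x^2 - 1) / x^2) * ((x^3 - 1) / x^3)^2 *
      ((x^4 - 1) / x^4)^3"
    unfolding accel_def x_def using assms by simp
  also have "\<dots> = ((x - 1)^2 * (x^2 - 1) * (x^3 - 1)^2 * (x^4 - 1)^3) /
      (x * (x - 2) * x^2 * (x^3)^2 * (x^4)^3)"
    by (simp only: power_divide times_divide_times_eq)
  also have "x * (x - 2) * x^2 * (x^3)^2 * (x^4)^3 = x ^ 21 * (x - 2)" by algebra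
  finally show ?thesis by (simp only: x_def)
qed

lemma accel_numeral_bounds:
  "accel 2 \<ge> 0.4731416702270 \<and> accel 2 \<le> 0.4731416702271"
  "accel 3 \<ge> 1.0588154897889 \<and> accel 3 \<le> 1.0588154897890"
  "accel 5 \<ge> 1.0028523994939 \<and> accel 5 \<le> 1.0028523994940"
  "accel 7 \<ge> 1.0004625368388 \<and> accel 7 \<le> 1.0004625368389"
  "accel 11 \<ge> 1.0000434285886 \<and> accel 11 \<le> 1.0000434285887"
  "accel 13 \<ge> 1.0000183542764 \<and> accel 13 \<le> 1.0000183542765"
  "accel 17 \<ge> 1.0000046473469 \<and> accel 17 \<le> 1.0000046473470"
  "accel 19 \<ge> 1.0000026365680 \<and> accel 19 \<le> 1.0000026365681"
  "accel 23 \<ge> 1.0000009987064 \<and> accel 23 \<le> 1.0000009987065"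
  "accel 29 \<ge> 1.0000003087620 \<and> accel 29 \<le> 1.0000003087621"
  "accel 31 \<ge> 1.0000002204090 \<and> accel 31 \<le> 1.0000002204091"
  "accel 37 \<ge> 1.0000000902315 \<and> accel 37 \<le> 1.0000000902316"
  "accel 41 \<ge> 1.0000000537793 \<and> accel 41 \<le> 1.0000000537794"
  "accel 43 \<ge> 1.0000000423066 \<and> accel 43 \<le> 1.0000000423067"
  "accel 47 \<ge> 1.0000000270332 \<and> accel 47 \<le> 1.0000000270333"
  "accel 53 \<ge> 1.0000000147692 \<and> accel 53 \<le> 1.0000000147693"
  "accel 59 \<ge> 1.0000000086133 \<and> accel 59 \<le> 1.0000000086134"
  \<comment> \<open>\<open>accel_eq\<close> excludes 2, so the first bracket is evaluated from the
    definition.\<close>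
  by (simp add: accel_def power2_eq_square power3_eq_cube) (simp_all add: accel_eq)

lemma accel_prod_60_bounds: "0.502666675760 \<le> accel_prod 60" "accel_prod 60 \<le> 0.502666675761"
proof -
  have eq: "accel_prod 60 = accel 2 * accel 3 * accel 5 * accel 7 * accel 11 * accel 13 *
      accel 17 * accel 19 * accel 23 * accel 29 * accel 31 * accel 37 * accel 41 * accel 43 *
      accel 47 * accel 53 * accel 59"
    unfolding accel_prod_def by (simp add: lessThan_nat_numeral mult_ac)
  note b = accel_numeral_bounds
  have "0.502666675760 \<le> (0.4731416702270::real) * 1.0588154897889 * 1.0028523994939 *
      1.0004625368388 * 1.0000434285886 * 1.0000183542764 * 1.0000046473469 * 1.0000026365680 *
      1.0000009987064 * 1.0000003087620 * 1.0000002204090 * 1.0000000902315 * 1.0000000537793 *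
      1.0000000423066 * 1.0000000270332 * 1.0000000147692 * 1.0000000086133"
    by simp
  also have "\<dots> \<le> accel_prod 60"
    unfolding eq by (intro mult_mono' b[THEN conjunct1]) simp_all
  finally show "0.502666675760 \<le> accel_prod 60" .
  have "accel_prod 60 \<le> (0.4731416702271::real) * 1.0588154897890 * 1.0028523994940 *
      1.0004625368389 * 1.0000434285887 * 1.0000183542765 * 1.0000046473470 * 1.0000026365681 *
      1.0000009987065 * 1.0000003087621 * 1.0000002204091 * 1.0000000902316 * 1.0000000537794 *
      1.0000000423067 * 1.0000000270333 * 1.0000000147693 * 1.0000000086134"
    unfolding eq by (intro mult_mono b[THEN conjunct2]) (simp_all add: accel_nonneg)
  also have "\<dots> \<le> 0.502666675761"
    by simp
  finally show "accel_prod 60 \<le> 0.502666675761" .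
qed

text \<open>The largest uncertainty is the tail beyond 60, of relative size 7/48469444; on
  \<open>beta 2\<close> it amounts to about 2.7 * 10^-8, within the tolerance for seven
  decimals.\<close>

lemma beta_2_approx: "\<bar>beta 2 - 0.1893475\<bar> < 0.00000005"
proof -
  define Z where "Z = (\<Sum>n. 1 / real n ^ 2) * (\<Sum>n. 1 / real n ^ 3) ^ 2 *
      (\<Sum>n. 1 / real n ^ 4) ^ 3"
  define B where "B = prime_prod (\<lambda>p. p > 2) (\<lambda>p. (1 - 1 / real p)\<^sup>2 / (1 - 2 / real p))"
  note z = zeta2_bounds zeta3_bounds zeta4_bounds
  have "3.0134881803 \<le> (1.64493406585::real) * 1.20205690309 ^ 2 * 1.08232323370 ^ 3"
    by (simp add: power2_eq_square power3_eq_cube)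
  also have "\<dots> \<le> Z" unfolding Z_def using z by (intro mult_mono power_mono mult_nonneg_nonneg) auto
  finally have Zl: "3.0134881803 \<le> Z" .
  have "Z \<le> 1.64493407109 * 1.20205690328 ^ 2 * 1.08232323372 ^ 3"
    unfolding Z_def using z by (intro mult_mono power_mono mult_nonneg_nonneg zero_le_power) auto
  also have "\<dots> \<le> 3.0134881911" by (simp add: power2_eq_square power3_eq_cube)
  finally have Zu: "Z \<le> 3.0134881911" .
  note v = accel_prod_60_bounds
  have lim: "(\<lambda>K. accel_prod K * Z) \<longlonglongrightarrow> B"
    unfolding Z_def B_def by (rule accel_prod_tendsto)
  have "3.0134881803 * 0.502666675760 \<le> accel_prod 60 * Z"
    unfolding mult.commute[of "accel_prod 60"] using Zl v by (intro mult_mono) auto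
  also have "accel_prod 60 * Z \<le> B"
    using Zl by (intro LIMSEQ_le_const[OF lim] exI[of _ 60] allI impI mult_right_mono accel_prod_bounds) auto
  finally have lower: "3.0134881803 * 0.502666675760 \<le> B" .
  have limB: "(\<lambda>K. accel_prod K * Z * (1 - 7 / 48469444)) \<longlonglongrightarrow> B *
      (1 - 7 / 48469444)"
    by (intro tendsto_intros lim)
  have bnd: "accel_prod K * Z * (1 - 7 / 48469444) \<le> 0.502666675761 *
      3.0134881911" if "60 \<le> K" for K
  proof -
    have "accel_prod K * Z * (1 - 7 / 48469444) = accel_prod K * (1 - 7 / 48469444) * Z"
      by (simp only: mult_ac)
    also have "\<dots> \<le> 0.502666675761 * 3.0134881911"
      using accel_prod_bounds(2)[OF that] v Zl Zu by (intro mult_mono) auto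
    finally show ?thesis .
  qed
  have "B * (1 - 7 / 48469444) \<le> 0.502666675761 * 3.0134881911"
    by (intro LIMSEQ_le_const2[OF limB] exI[of _ 60] allI impI bnd)
  moreover have "beta 2 = 1 / 8 * B" unfolding B_def by (rule beta_2_eq)
  ultimately show ?thesis using lower by (simp add: abs_less_iff)
qed

theorem theorem1p3:
  shows "(\<lambda>k. nu_coeff k - of_real (beta 2) / 2 ^ k) \<in> O(\<lambda>k. 1 / 3 ^ k) \<and>
    beta 2 = 1 / 8 *
      prime_prod (\<lambda>p. p > 2) (\<lambda>p. (1 - 1 / real p)\<^sup>2 / (1 - 2 / real p)) \<and>
    \<bar>beta 2 - 0.1893475\<bar> < 0.00000005 \<and>
    (\<forall>q::nat. prime q \<longrightarrow>
      (\<lambda>k. nu_coeff k - (\<Sum>p | prime p \<and> p < q. of_real (beta p) / of_nat p ^ k))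
        \<in> O(\<lambda>k. 1 / of_nat q ^ k))"
proof (intro conjI allI impI)
  \<comment> \<open>The first claim is the general expansion at q = 3.\<close>
  have "{p::nat. prime p \<and> p < 3} = {2}"
    using prime_ge_2_nat by (fastforce simp: numeral_3_eq_3 less_Suc_eq)
  thus "(\<lambda>k. nu_coeff k - of_real (beta 2) / 2 ^ k) \<in> O(\<lambda>k. 1 / 3 ^ k)"
    using nu_coeff_bigo[of 3] by simp
qed (fact beta_2_eq beta_2_approx nu_coeff_bigo)+

end
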